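(* Let $1\leq p_1\leq p_2<\infty$, let $\phi_1\in\mathcal{G}_{p_1}$ and $\phi_2\in\mathcal{G}_{p_2}$. Then the following statements are equivalent: (i) there exists $C>0$ such that $\phi_2(2N+1)\leq C\,\phi_1(2N+1)$ for every $N\in\omega$; (ii) there exists $C>0$ such that $\|x\|_{\ell^{p_1}_{\phi_1}}\leq C\,\|x\|_{\ell^{p_2}_{\phi_2}}$ for every $x\in\ell^{p_2}_{\phi_2}$; (iii) $\ell^{p_2}_{\phi_2}\subseteq\ell^{p_1}_{\phi_1}$.
   Context: Let $\mathbb{K}$ be $\mathbb{R}$ or $\mathbb{C}$, and $\omega=\mathbb{N}\cup\{0\}=\{0,1,2,\dots\}$. For $m\in\mathbb{Z}$ and $N\in\omega$ put $S_{m,N}=\{m-N,\dots,m,\dots,m+N\}$, and let $|S|$ denote the cardinality of a finite set $S$, so $|S_{m,N}|=2N+1$. Let $2\omega+1=\{2N+1: N\in\omega\}$. For $1\leq p<\infty$, $\mathcal{G}_p$ is the set of all functions $\phi:2\omega+1\to(0,\infty)$ such that (a) $\phi$ is almost decreasing: there exists $C>0$ with $\phi(2M+1)\geq C\,\phi(2N+1)$ for all $M,N\in\omega$ with $M\leq N$; and (b) $(2N+1)\mapsto(2N+1)^{1/p}\phi(2N+1)$ is almost increasing: there exists $C>0$ with $(2M+1)^{1/p}\phi(2M+1)\leq C\,(2N+1)^{1/p}\phi(2N+1)$ for all $M,N\in\omega$ with $M\leq N$. For $1\leq p<\infty$ and $\phi\in\mathcal{G}_p$, the generalized discrete Morrey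 space $\ell^p_\phi$ is the set of all sequences $x=(x_k)_{k\in\mathbb{Z}}$ in $\mathbb{K}$ such that $$\|x\|_{\ell^p_\phi}:=\sup_{m\in\mathbb{Z},\,N\in\omega}\frac{1}{\phi(2N+1)}\left(\frac{1}{|S_{m,N}|}\sum_{k\in S_{m,N}}|x_k|^p\right)^{1/p}<\infty.$$ The expression $\|x\|_{\ell^p_\phi}\in[0,\infty]$ is defined by the same supremum for every sequence $x$. *)

theory Defs
  imports Complex_Main "HOL-Library.Extended_Nonnegative_Real"
begin

definition discrete_interval :: "int \<Rightarrow> nat \<Rightarrow> int set" where
  "discrete_interval m N = {m - int N..m + int N}"

text \<open>
  A function on the odd naturals \<open>2\<omega> + 1\<close> is encoded as a total function on \<^typ>\<open>nat\<close>
  that is only ever evaluated at arguments of the form \<open>2 * N + 1\<close>.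
\<close>

definition morrey_weights :: "real \<Rightarrow> (nat \<Rightarrow> real) set" where
  "morrey_weights p = {\<phi>.
     (\<forall>N. \<phi> (2 * N + 1) > 0) \<and>
     (\<exists>C>0. \<forall>M N. M \<le> N \<longrightarrow> \<phi> (2 * M + 1) \<ge> C * \<phi> (2 * N + 1)) \<and>
     (\<exists>C>0. \<forall>M N. M \<le> N \<longrightarrow>
        real (2 * M + 1) powr (1 / p) * \<phi> (2 * M + 1)
          \<le> C * (real (2 * N + 1) powr (1 / p) * \<phi> (2 * N + 1)))}"

text \<open>
  The scalars range over the class \<^class>\<open>real_normed_field\<close>. Its norm is multiplicative, so by the
  Gelfand-Mazur theorem its instances are, up to isometric isomorphism, exactly the real and the
  complex numbers.
\<close>

definition morrey_norm ::
    "real \<Rightarrow> (nat \<Rightarrow> real) \<Rightarrow> (int \<Rightarrow> 'a::real_normed_field) \<Rightarrow> ennreal" where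
  "morrey_norm p \<phi> x = (SUP (m, N) \<in> UNIV. ennreal
     (1 / \<phi> (2 * N + 1) *
       (1 / real (card (discrete_interval m N)) *
         (\<Sum>k\<in>discrete_interval m N. norm (x k) powr p)) powr (1 / p)))"

definition morrey_space ::
    "real \<Rightarrow> (nat \<Rightarrow> real) \<Rightarrow> (int \<Rightarrow> 'a::real_normed_field) set" where
  "morrey_space p \<phi> = {x. morrey_norm p \<phi> x < \<infinity>}"

end

theory Submission
  imports Defs "HOL-Analysis.Convex"
begin

text \<open>
  If \<open>\<phi>2 \<le> C \<phi>1\<close>, the norm estimate is the monotonicity of power means in the exponent
  (\<open>power_mean_mono\<close>), applied on every interval separately; the norm estimate trivially gives the
  inclusion of the spaces.

  The implication from the inclusion back to \<open>\<phi>2 \<le> C \<phi>1\<close> is a gliding hump argument. If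
  \<open>\<phi>2 / \<phi>1\<close> is unbounded, choose \<open>N\<^sub>j\<close> with \<open>\<phi>2(2N\<^sub>j+1) > 4\<^bsup>j+1\<^esup> \<phi>1(2N\<^sub>j+1)\<close>.
  The sequences \<open>\<phi>2(2N\<^sub>j+1) 1\<^bsub>[-N\<^sub>j,N\<^sub>j]\<^esub>\<close> have uniformly bounded \<open>(p2, \<phi>2)\<close>-norm
  (\<open>scaled_box_average_le\<close>); this is the only place where the two monotonicity properties of \<open>\<phi>2\<close>
  enter. They are superposed, with weights \<open>2\<^bsup>-(j+1)\<^esup>\<close> of sum \<open>1\<close>, at the level of
  \<open>p2\<close>-th powers: \<open>\<bar>x\<^sub>k\<bar>\<^bsup>p2\<^esup> = (\<Sum>j. 2\<^bsup>-(j+1)\<^esup> \<phi>2(2N\<^sub>j+1)\<^bsup>p2\<^esup> 1\<^bsub>[-N\<^sub>j,N\<^sub>j]\<^esub>(k))\<close>.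
  The averages of \<open>\<bar>x\<bar>\<^bsup>p2\<^esup>\<close> are then linear in the summands, so they inherit the uniform bound
  and \<open>x\<close> has finite \<open>(p2, \<phi>2)\<close>-norm. On the other hand \<open>\<bar>x\<bar> \<ge> 2\<^bsup>-(j+1)\<^esup> \<phi>2(2N\<^sub>j+1)\<close> on
  \<open>[-N\<^sub>j,N\<^sub>j]\<close>, which forces the \<open>(p1, \<phi>1)\<close>-norm of \<open>x\<close> above \<open>2\<^bsup>j+1\<^esup>\<close> for every \<open>j\<close>.
\<close>

section \<open>Power means\<close>

text \<open>
  The endpoint \<open>0\<close>, where \<open>x\<^bsup>r\<^esup>\<close> may fail to be twice differentiable, matters because
  sequences vanish at some indices. There convexity reduces to \<open>t\<^bsup>r\<^esup> \<le> t\<close> for \<open>0 \<le> t \<le> 1\<close>.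
\<close>

lemma convex_on_powr_nonneg:
  fixes r :: real
  assumes "1 \<le> r"
  shows "convex_on {0..} (\<lambda>x. x powr r)"
proof (rule convex_onI)
  fix t x y :: real
  assume t: "0 < t" "t < 1" and xy: "x \<in> {0..}" "y \<in> {0..}"
  have scale: "(s * z) powr r \<le> s * z powr r" if "0 \<le> s" "s \<le> 1" "0 \<le> z" for s z :: real
    using that assms powr_mono'[of 1 r s] by (simp add: powr_mult mult_right_mono)
  consider "x = 0" | "y = 0" | "0 < x" "0 < y" using xy by fastforce
  then show "((1 - t) *\<^sub>R x + t *\<^sub>R y) powr r \<le> (1 - t) * x powr r + t * y powr r"
  proof cases
    case 1
    then show ?thesis using scale[of t y] t xy by simp
  next
    case 2
    then show ?thesis using scale[of "1 - t" x] t xy by simp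
  next
    case 3
    then show ?thesis using convex_onD[OF powr_convex[OF assms], of t x y] t by simp
  qed
qed simp

text \<open>Jensen's inequality for \<open>u \<mapsto> u\<^bsup>q/p\<^esup>\<close>, applied to the numbers \<open>a\<^sub>k\<^bsup>p\<^esup>\<close>.\<close>

lemma power_mean_mono:
  fixes a :: "'b \<Rightarrow> real" and p q :: real
  assumes "finite S" "S \<noteq> {}" "0 < p" "p \<le> q" and nonneg: "\<And>k. k \<in> S \<Longrightarrow> 0 \<le> a k"
  shows "(1 / real (card S) * (\<Sum>k\<in>S. a k powr p)) powr (1 / p)
      \<le> (1 / real (card S) * (\<Sum>k\<in>S. a k powr q)) powr (1 / q)"
proof -
  define A where "A = 1 / real (card S) * (\<Sum>k\<in>S. a k powr p)"
  define B where "B = 1 / real (card S) * (\<Sum>k\<in>S. a k powr q)"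
  have A0: "0 \<le> A" unfolding A_def by (simp add: sum_nonneg)
  have "(\<Sum>k\<in>S. (1 / real (card S)) *\<^sub>R (a k powr p)) powr (q / p)
      \<le> (\<Sum>k\<in>S. 1 / real (card S) * (a k powr p) powr (q / p))"
    using assms by (intro convex_on_sum[where C = "{0..}"] convex_on_powr_nonneg) auto
  also have "(\<Sum>k\<in>S. (1 / real (card S)) *\<^sub>R (a k powr p)) = A"
    by (simp add: A_def sum_distrib_left)
  also have "(\<Sum>k\<in>S. 1 / real (card S) * (a k powr p) powr (q / p)) = B"
    using assms by (simp add: B_def sum_distrib_left powr_powr)
  finally have "(A powr (q / p)) powr (1 / q) \<le> B powr (1 / q)"
    using assms by (intro powr_mono2) auto
  then show ?thesis
    using assms A0 by (simp add: powr_powr A_def B_def)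
qed

section \<open>Averages over intervals and the Morrey norm\<close>

lemma finite_discrete_interval [simp]: "finite (discrete_interval m N)"
  by (simp add: discrete_interval_def)

lemma card_discrete_interval [simp]: "card (discrete_interval m N) = 2 * N + 1"
  by (simp add: discrete_interval_def)

lemma discrete_interval_nonempty [simp]: "discrete_interval m N \<noteq> {}"
  by (simp add: discrete_interval_def)

lemma morrey_norm_le_iff:
  assumes "\<And>N. 0 < \<phi> (2 * N + 1)" and "0 \<le> K"
  shows "morrey_norm p \<phi> x \<le> ennreal K \<longleftrightarrow>
    (\<forall>m N. (1 / real (card (discrete_interval m N)) *
       (\<Sum>k\<in>discrete_interval m N. norm (x k) powr p)) powr (1 / p) \<le> K * \<phi> (2 * N + 1))"
proof -
  have "\<phi> (Suc (2 * N)) > 0" for N using assms(1)[of N] by simp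
  then show ?thesis using assms(2)
    by (simp add: morrey_norm_def SUP_le_iff ennreal_le_iff divide_le_eq)
qed

lemma morrey_space_iff:
  assumes "\<And>N. 0 < \<phi> (2 * N + 1)"
  shows "x \<in> morrey_space p \<phi> \<longleftrightarrow> (\<exists>K\<ge>0. \<forall>m N.
     (1 / real (card (discrete_interval m N)) *
       (\<Sum>k\<in>discrete_interval m N. norm (x k) powr p)) powr (1 / p) \<le> K * \<phi> (2 * N + 1))"
proof -
  have "x \<in> morrey_space p \<phi> \<longleftrightarrow> (\<exists>K\<ge>0. morrey_norm p \<phi> x \<le> ennreal K)"
  proof
    assume "x \<in> morrey_space p \<phi>"
    then have "morrey_norm p \<phi> x < top" by (simp add: morrey_space_def)
    then show "\<exists>K\<ge>0. morrey_norm p \<phi> x \<le> ennreal K"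
      by (intro exI[of _ "enn2real (morrey_norm p \<phi> x)"]) simp
  qed (auto simp: morrey_space_def intro: le_less_trans)
  then show ?thesis by (simp only: morrey_norm_le_iff[where \<phi> = \<phi>, OF assms] cong: conj_cong)
qed

lemma morrey_norm_le_if_weight_le:
  fixes x :: "int \<Rightarrow> 'a::real_normed_field"
  assumes "1 \<le> p1" "p1 \<le> p2" "0 < C"
    and pos1: "\<And>N. 0 < \<phi>1 (2 * N + 1)" and pos2: "\<And>N. 0 < \<phi>2 (2 * N + 1)"
    and le: "\<And>N. \<phi>2 (2 * N + 1) \<le> C * \<phi>1 (2 * N + 1)"
    and x: "x \<in> morrey_space p2 \<phi>2"
  shows "morrey_norm p1 \<phi>1 x \<le> ennreal C * morrey_norm p2 \<phi>2 x"
proof -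
  define K where "K = enn2real (morrey_norm p2 \<phi>2 x)"
  have K: "0 \<le> K" "morrey_norm p2 \<phi>2 x = ennreal K"
    using x by (auto simp: K_def morrey_space_def)
  have "(1 / real (card (discrete_interval m N)) *
       (\<Sum>k\<in>discrete_interval m N. norm (x k) powr p1)) powr (1 / p1) \<le> C * K * \<phi>1 (2 * N + 1)"
    for m N
  proof -
    have "(1 / real (card (discrete_interval m N)) *
        (\<Sum>k\<in>discrete_interval m N. norm (x k) powr p1)) powr (1 / p1)
      \<le> (1 / real (card (discrete_interval m N)) *
        (\<Sum>k\<in>discrete_interval m N. norm (x k) powr p2)) powr (1 / p2)"
      using assms by (intro power_mean_mono) auto
    also have "\<dots> \<le> K * \<phi>2 (2 * N + 1)"
      using morrey_norm_le_iff[of \<phi>2 K p2 x] pos2 K by simp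
    also have "\<dots> \<le> K * (C * \<phi>1 (2 * N + 1))"
      using le K by (intro mult_left_mono) auto
    finally show ?thesis by (simp add: mult_ac)
  qed
  then have "morrey_norm p1 \<phi>1 x \<le> ennreal (C * K)"
    using morrey_norm_le_iff[of \<phi>1 "C * K" p1 x] pos1 K \<open>0 < C\<close> by simp
  then show ?thesis using K \<open>0 < C\<close> by (simp add: ennreal_mult)
qed

section \<open>The gliding hump\<close>

text \<open>
  Average the \<open>p\<close>-th power of \<open>\<phi>(2N+1) 1\<^bsub>[-N,N]\<^esub>\<close> over an interval of length \<open>2M+1\<close>.
  If \<open>M \<le> N\<close>, the indicator is at most \<open>1\<close> and \<open>\<phi>(2N+1)\<close> is controlled by \<open>\<phi>(2M+1)\<close>
  because \<open>\<phi>\<close> is almost decreasing. If \<open>N \<le> M\<close>, the indicator contributes at most \<open>2N+1\<close> points, and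
  \<open>(2N+1) \<phi>(2N+1)\<^bsup>p\<^esup>\<close> is controlled by \<open>(2M+1) \<phi>(2M+1)\<^bsup>p\<^esup>\<close>.
\<close>

lemma scaled_box_average_le:
  assumes "1 \<le> p" and "\<phi> \<in> morrey_weights p"
  shows "\<exists>K>0. \<forall>m M N.
    (\<Sum>k\<in>discrete_interval m M. \<phi> (2 * N + 1) powr p * indicator (discrete_interval 0 N) k)
      \<le> K * (real (2 * M + 1) * \<phi> (2 * M + 1) powr p)"
proof -
  have pos: "0 < \<phi> (2 * N + 1)" for N using assms(2) by (simp add: morrey_weights_def)
  obtain c where c: "0 < c" "\<And>M N. M \<le> N \<Longrightarrow> c * \<phi> (2 * N + 1) \<le> \<phi> (2 * M + 1)"
    using assms(2) unfolding morrey_weights_def by blast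
  obtain C where C: "0 < C" "\<And>M N. M \<le> N \<Longrightarrow> real (2 * M + 1) powr (1 / p) * \<phi> (2 * M + 1)
      \<le> C * (real (2 * N + 1) powr (1 / p) * \<phi> (2 * N + 1))"
    using assms(2) unfolding morrey_weights_def by blast
  define K where "K = (1 / c) powr p + C powr p"
  have K: "0 < K" using c C by (simp add: K_def add_pos_pos)
  have "(\<Sum>k\<in>discrete_interval m M. \<phi> (2 * N + 1) powr p * indicator (discrete_interval 0 N) k)
      \<le> K * (real (2 * M + 1) * \<phi> (2 * M + 1) powr p)" for m M N
  proof -
    have sum_eq: "(\<Sum>k\<in>discrete_interval m M.
        \<phi> (2 * N + 1) powr p * indicator (discrete_interval 0 N) k)
        = real (card (discrete_interval m M \<inter> discrete_interval 0 N)) * \<phi> (2 * N + 1) powr p"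
      by (simp add: sum_distrib_left[symmetric] indicator_def sum.If_cases Int_def)
    show ?thesis
    proof (cases "M \<le> N")
      case True
      have "real (card (discrete_interval m M \<inter> discrete_interval 0 N)) \<le> real (2 * M + 1)"
        using card_mono[of "discrete_interval m M" "discrete_interval m M \<inter> discrete_interval 0 N"]
        by simp
      moreover have "\<phi> (2 * N + 1) powr p \<le> (1 / c * \<phi> (2 * M + 1)) powr p"
        using c(1) c(2)[OF True] pos[of N] assms(1)
        by (intro powr_mono2) (auto simp: field_simps)
      moreover have "(1 / c * \<phi> (2 * M + 1)) powr p = (1 / c) powr p * \<phi> (2 * M + 1) powr p"
        using c(1) pos[of M] by (intro powr_mult)
      moreover have "\<dots> \<le> K * \<phi> (2 * M + 1) powr p"
        by (intro mult_right_mono) (auto simp: K_def)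
      ultimately have "real (card (discrete_interval m M \<inter> discrete_interval 0 N))
          * \<phi> (2 * N + 1) powr p \<le> real (2 * M + 1) * (K * \<phi> (2 * M + 1) powr p)"
        by (intro mult_mono) auto
      also have "\<dots> = K * (real (2 * M + 1) * \<phi> (2 * M + 1) powr p)"
        by (rule mult.left_commute)
      finally show ?thesis by (simp only: sum_eq)
    next
      case False
      have root: "(real (2 * L + 1) powr (1 / p) * \<phi> (2 * L + 1)) powr p
          = real (2 * L + 1) * \<phi> (2 * L + 1) powr p" for L
        using pos[of L] assms(1) by (simp add: powr_mult powr_powr del: of_nat_add of_nat_mult of_nat_Suc)
      have "real (card (discrete_interval m M \<inter> discrete_interval 0 N)) \<le> real (2 * N + 1)"
        using card_mono[of "discrete_interval 0 N" "discrete_interval m M \<inter> discrete_interval 0 N"]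
        by simp
      then have "real (card (discrete_interval m M \<inter> discrete_interval 0 N))
          * \<phi> (2 * N + 1) powr p \<le> real (2 * N + 1) * \<phi> (2 * N + 1) powr p"
        by (intro mult_right_mono) auto
      also have "\<dots> = (real (2 * N + 1) powr (1 / p) * \<phi> (2 * N + 1)) powr p"
        by (rule root[symmetric])
      also have "\<dots> \<le> (C * (real (2 * M + 1) powr (1 / p) * \<phi> (2 * M + 1))) powr p"
        using C(2)[of N M] False pos[of N] assms(1) by (intro powr_mono2 mult_nonneg_nonneg) auto
      also have "\<dots> = C powr p * (real (2 * M + 1) powr (1 / p) * \<phi> (2 * M + 1)) powr p"
        by (rule powr_mult)
      also have "\<dots> = C powr p * (real (2 * M + 1) * \<phi> (2 * M + 1) powr p)"
        by (simp only: root)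
      also have "\<dots> \<le> K * (real (2 * M + 1) * \<phi> (2 * M + 1) powr p)"
        by (intro mult_right_mono) (auto simp: K_def)
      finally show ?thesis by (simp only: sum_eq)
    qed
  qed
  then show ?thesis using K by blast
qed

text \<open>
  One element of the space that is large on all the prescribed intervals \<open>[-N\<^sub>j,N\<^sub>j]\<close> at once, at
  the cost of a factor \<open>2\<^bsup>-(j+1)\<^esup>\<close>. The value \<open>\<phi>(2N+1)\<close> is the largest one, up to
  a constant, that a function of norm \<open>1\<close> can take throughout \<open>[-N,N]\<close>.
\<close>

lemma ex_morrey_space_ge_on_intervals:
  fixes n :: "nat \<Rightarrow> nat"
  assumes p: "1 \<le> p" and \<phi>: "\<phi> \<in> morrey_weights p"
  shows "\<exists>x \<in> (morrey_space p \<phi> :: (int \<Rightarrow> 'a::real_normed_field) set).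
    \<forall>j. \<forall>k\<in>discrete_interval 0 (n j). (1 / 2) ^ Suc j * \<phi> (2 * n j + 1) \<le> norm (x k)"
proof -
  have pos: "0 < \<phi> (2 * N + 1)" for N using \<phi> by (simp add: morrey_weights_def)
  define f where
    "f k j = \<phi> (2 * n j + 1) powr p * indicator (discrete_interval 0 (n j)) k" for k :: int and j
  obtain K where K: "0 < K"
    "\<And>m M j. (\<Sum>k\<in>discrete_interval m M. f k j) \<le> K * (real (2 * M + 1) * \<phi> (2 * M + 1) powr p)"
    using scaled_box_average_le[OF p \<phi>] unfolding f_def by blast
  have f0: "0 \<le> f k j" for k j by (simp add: f_def)
  \<comment> \<open>Intervals with a single point (\<open>M = 0\<close>) turn the bound on averages into a pointwise one.\<close>
  have f_le: "f k j \<le> K * \<phi> 1 powr p" for k j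
    using K(2)[where m = k and M = 0 and j = j] by (simp add: discrete_interval_def)
  have half: "(\<lambda>j. (1 / 2 :: real) ^ Suc j) sums 1" by (rule power_half_series)
  have summ: "summable (\<lambda>j. (1 / 2) ^ Suc j * f k j)" for k
  proof (rule summable_comparison_test')
    show "summable (\<lambda>j. (1 / 2) ^ Suc j * (K * \<phi> 1 powr p))"
      using half by (intro summable_mult2) (rule sums_summable)
    show "norm ((1 / 2) ^ Suc j * f k j) \<le> (1 / 2) ^ Suc j * (K * \<phi> 1 powr p)" for j
      using f0[of k j] f_le[of k j] by simp
  qed
  define y where "y k = (\<Sum>j. (1 / 2) ^ Suc j * f k j)" for k
  have y_ge: "(1 / 2) ^ Suc j * f k j \<le> y k" for k j
    unfolding y_def using sum_le_suminf[OF summ[of k], of "{j}"] f0 by simp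
  have y0: "0 \<le> y k" for k
    unfolding y_def using summ f0 by (intro suminf_nonneg) auto
  define x where "x k = (of_real (y k powr (1 / p)) :: 'a)" for k
  have norm_x: "norm (x k) = y k powr (1 / p)" for k by (simp add: x_def)
  have norm_x_powr: "norm (x k) powr p = y k" for k
    using p y0[of k] by (simp add: norm_x powr_powr)
  have "(1 / real (card (discrete_interval m M)) *
      (\<Sum>k\<in>discrete_interval m M. norm (x k) powr p)) powr (1 / p)
      \<le> K powr (1 / p) * \<phi> (2 * M + 1)" for m M
  proof -
    let ?B = "K * (real (2 * M + 1) * \<phi> (2 * M + 1) powr p)"
    have "(\<Sum>k\<in>discrete_interval m M. norm (x k) powr p)
        = (\<Sum>j. \<Sum>k\<in>discrete_interval m M. (1 / 2) ^ Suc j * f k j)"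
      using summ by (simp only: norm_x_powr y_def suminf_sum)
    also have "\<dots> = (\<Sum>j. (1 / 2) ^ Suc j * (\<Sum>k\<in>discrete_interval m M. f k j))"
      by (simp only: sum_distrib_left)
    also have "\<dots> \<le> (\<Sum>j. (1 / 2) ^ Suc j * ?B)"
    proof (rule suminf_le)
      show "summable (\<lambda>j. (1 / 2) ^ Suc j * (\<Sum>k\<in>discrete_interval m M. f k j))"
        unfolding sum_distrib_left by (intro summable_sum summ)
      show "summable (\<lambda>j. (1 / 2) ^ Suc j * ?B)"
        using half by (intro summable_mult2) (rule sums_summable)
      show "(1 / 2) ^ Suc j * (\<Sum>k\<in>discrete_interval m M. f k j) \<le> (1 / 2) ^ Suc j * ?B" for j
        by (intro mult_left_mono K(2)) simp
    qed
    also have "\<dots> = ?B"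
      using sums_unique[OF sums_mult2[OF half, of ?B]] by simp
    finally have "1 / real (card (discrete_interval m M)) *
        (\<Sum>k\<in>discrete_interval m M. norm (x k) powr p) \<le> K * \<phi> (2 * M + 1) powr p"
      by (simp add: divide_le_eq mult_ac)
    then have "(1 / real (card (discrete_interval m M)) *
        (\<Sum>k\<in>discrete_interval m M. norm (x k) powr p)) powr (1 / p)
        \<le> (K * \<phi> (2 * M + 1) powr p) powr (1 / p)"
      using p by (intro powr_mono2 mult_nonneg_nonneg sum_nonneg) auto
    also have "\<dots> = K powr (1 / p) * \<phi> (2 * M + 1)"
      using p pos[of M] by (simp add: powr_mult powr_powr)
    finally show ?thesis .
  qed
  then have "x \<in> morrey_space p \<phi>"
    using pos by (subst morrey_space_iff) (auto intro!: exI[of _ "K powr (1 / p)"])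
  moreover have "(1 / 2) ^ Suc j * \<phi> (2 * n j + 1) \<le> norm (x k)"
    if k: "k \<in> discrete_interval 0 (n j)" for j k
  proof -
    define h where "h = (1 / 2 :: real) ^ Suc j"
    have h: "0 < h" "h \<le> 1" unfolding h_def by (auto intro!: power_le_one simp del: power_Suc)
    \<comment> \<open>The weight \<open>h\<close> multiplies \<open>p\<close>-th powers; its \<open>p\<close>-th root is at least \<open>h\<close> as \<open>h \<le> 1\<close>.\<close>
    have "h \<le> h powr (1 / p)"
      using powr_mono'[of "1 / p" 1 h] h p by simp
    then have "h * \<phi> (2 * n j + 1) \<le> h powr (1 / p) * \<phi> (2 * n j + 1)"
      using pos[of "n j"] by (intro mult_right_mono) auto
    also have "\<dots> = (h * \<phi> (2 * n j + 1) powr p) powr (1 / p)"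
      using p h pos[of "n j"] by (simp add: powr_mult powr_powr)
    also have "\<dots> \<le> norm (x k)"
      unfolding norm_x using y_ge[of j k] k p h by (intro powr_mono2) (auto simp: f_def h_def)
    finally show ?thesis by (simp add: h_def)
  qed
  ultimately show ?thesis by blast
qed

text \<open>
  The ratio \<open>\<phi>2 / \<phi>1\<close> must beat the loss \<open>2\<^bsup>-(j+1)\<^esup>\<close> of the previous lemma by an unbounded
  factor, hence the powers of \<open>4\<close>.
\<close>

lemma weight_le_if_morrey_space_subset:
  assumes "1 \<le> p1" "1 \<le> p2" and pos1: "\<And>N. 0 < \<phi>1 (2 * N + 1)"
    and \<phi>2: "\<phi>2 \<in> morrey_weights p2"
    and sub: "(morrey_space p2 \<phi>2 :: (int \<Rightarrow> 'a::real_normed_field) set) \<subseteq> morrey_space p1 \<phi>1"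
  shows "\<exists>C>0. \<forall>N. \<phi>2 (2 * N + 1) \<le> C * \<phi>1 (2 * N + 1)"
proof (rule ccontr)
  assume "\<not> ?thesis"
  then have "\<exists>N. C * \<phi>1 (2 * N + 1) < \<phi>2 (2 * N + 1)" if "0 < C" for C
    using that by (meson not_le)
  then have "\<forall>j. \<exists>N. 4 ^ Suc j * \<phi>1 (2 * N + 1) < \<phi>2 (2 * N + 1)" by simp
  then obtain n where n: "\<And>j. 4 ^ Suc j * \<phi>1 (2 * n j + 1) < \<phi>2 (2 * n j + 1)"
    by metis
  obtain x :: "int \<Rightarrow> 'a" where x: "x \<in> morrey_space p2 \<phi>2"
    "\<And>j k. k \<in> discrete_interval 0 (n j) \<Longrightarrow> (1 / 2) ^ Suc j * \<phi>2 (2 * n j + 1) \<le> norm (x k)"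
    using ex_morrey_space_ge_on_intervals[OF \<open>1 \<le> p2\<close> \<phi>2] by metis
  have "x \<in> morrey_space p1 \<phi>1" using sub x by blast
  then obtain K where K: "\<And>m N. (1 / real (card (discrete_interval m N)) *
      (\<Sum>k\<in>discrete_interval m N. norm (x k) powr p1)) powr (1 / p1) \<le> K * \<phi>1 (2 * N + 1)"
    using morrey_space_iff[of \<phi>1 x p1] pos1 by blast
  have "2 ^ Suc j \<le> K" for j
  proof -
    let ?b = "2 ^ Suc j * \<phi>1 (2 * n j + 1)"
    let ?S = "discrete_interval 0 (n j)"
    have b0: "0 < ?b" using pos1[of "n j"] by simp
    have b_le: "?b \<le> norm (x k)" if "k \<in> ?S" for k
    proof -
      have "?b = (1 / 2) ^ Suc j * (4 ^ Suc j * \<phi>1 (2 * n j + 1))"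
        by (simp only: mult.assoc[symmetric] power_mult_distrib[symmetric]) simp
      also have "\<dots> \<le> (1 / 2) ^ Suc j * \<phi>2 (2 * n j + 1)"
        using n[of j] by (intro mult_left_mono) auto
      finally show ?thesis using x(2)[OF that] by simp
    qed
    have "(\<Sum>k\<in>?S. ?b powr p1) \<le> (\<Sum>k\<in>?S. norm (x k) powr p1)"
      using b0 b_le \<open>1 \<le> p1\<close> by (intro sum_mono powr_mono2) auto
    then have avg: "?b powr p1 \<le> 1 / real (card ?S) * (\<Sum>k\<in>?S. norm (x k) powr p1)"
      by (simp add: field_simps)
    have "?b = (?b powr p1) powr (1 / p1)"
      using \<open>1 \<le> p1\<close> b0 by (simp add: powr_powr)
    also have "\<dots> \<le> (1 / real (card ?S) * (\<Sum>k\<in>?S. norm (x k) powr p1)) powr (1 / p1)"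
      using avg \<open>1 \<le> p1\<close> by (intro powr_mono2) auto
    also have "\<dots> \<le> K * \<phi>1 (2 * n j + 1)" by (rule K)
    finally show ?thesis using pos1[of "n j"] by (simp only: mult_le_cancel_right_pos)
  qed
  moreover obtain j where "K < 2 ^ j" using real_arch_pow[of 2 K] by auto
  ultimately have "(2::real) ^ Suc j < 2 ^ j" by (meson le_less_trans)
  then show False by simp
qed

section \<open>The inclusion theorem\<close>

theorem theorem4p3:
  fixes p1 p2 :: real and \<phi>1 \<phi>2 :: "nat \<Rightarrow> real"
  assumes "1 \<le> p1" and "p1 \<le> p2"
    and "\<phi>1 \<in> morrey_weights p1" and "\<phi>2 \<in> morrey_weights p2"
  shows "((\<exists>C>0. \<forall>N. \<phi>2 (2 * N + 1) \<le> C * \<phi>1 (2 * N + 1)) \<longleftrightarrow>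
          (\<exists>C>0. \<forall>x \<in> (morrey_space p2 \<phi>2 :: (int \<Rightarrow> 'a::real_normed_field) set).
             morrey_norm p1 \<phi>1 x \<le> ennreal C * morrey_norm p2 \<phi>2 x)) \<and>
         ((\<exists>C>0. \<forall>x \<in> (morrey_space p2 \<phi>2 :: (int \<Rightarrow> 'a) set).
             morrey_norm p1 \<phi>1 x \<le> ennreal C * morrey_norm p2 \<phi>2 x) \<longleftrightarrow>
          (morrey_space p2 \<phi>2 :: (int \<Rightarrow> 'a) set) \<subseteq> morrey_space p1 \<phi>1)"
    (is "(?i \<longleftrightarrow> ?ii) \<and> (?ii \<longleftrightarrow> ?iii)")
proof -
  have pos: "0 < \<phi>1 (2 * N + 1)" "0 < \<phi>2 (2 * N + 1)" for N
    using assms(3,4) by (simp_all add: morrey_weights_def)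
  have "?ii" if "?i"
    using that morrey_norm_le_if_weight_le[where ?\<phi>1.0 = \<phi>1 and ?\<phi>2.0 = \<phi>2, OF assms(1,2) _ pos]
    by meson
  moreover have "?iii" if "?ii"
  proof
    obtain C where C: "\<forall>x \<in> (morrey_space p2 \<phi>2 :: (int \<Rightarrow> 'a) set).
        morrey_norm p1 \<phi>1 x \<le> ennreal C * morrey_norm p2 \<phi>2 x"
      using \<open>?ii\<close> by blast
    fix x :: "int \<Rightarrow> 'a"
    assume x: "x \<in> morrey_space p2 \<phi>2"
    then have "morrey_norm p1 \<phi>1 x \<le> ennreal C * morrey_norm p2 \<phi>2 x" using C by blast
    also have "\<dots> < \<infinity>" using x by (simp add: morrey_space_def ennreal_mult_less_top)
    finally show "x \<in> morrey_space p1 \<phi>1" by (simp add: morrey_space_def)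
  qed
  moreover have "?i" if "?iii"
    using weight_le_if_morrey_space_subset[where ?\<phi>1.0 = \<phi>1, OF assms(1) _ pos(1) assms(4) that] assms(1,2) by simp
  ultimately show ?thesis by blast
qed

end
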